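(* Suppose $\gamma:\mathbb{S}^1\to\mathbb{R}^2$ is a smooth immersed closed curve with winding number $\omega$, and let $m$ denote the maximum number of times $\gamma$ intersects itself in any one point; that is, $$\int_\gamma k\,ds=2\omega\pi\quad\text{and}\quad m=m(\gamma)=\sup_{x\in\mathbb{R}^2}|\gamma^{-1}(x)|,$$ where $|\gamma^{-1}(x)|$ is the number of preimages of $x$ in $\mathbb{S}^1$. Then $$K_{osc}(\gamma)\ge16m^2-4\omega^2\pi^2.$$
   Context: For a closed immersed plane curve $\gamma$ with arc-length $s$ (where $ds=|\gamma_u|\,du$) and unit normal field $\nu$: the curvature is $k=\langle\gamma_{ss},\nu\rangle$; the length is $L(\gamma)=\int|\gamma_u|\,du$; the average curvature is $\overline{k}=\frac1L\int_\gamma k\,ds$; and $K_{osc}(\gamma)=L(\gamma)\int_\gamma(k-\overline{k})^2\,ds$. *)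

theory Defs
  imports "HOL-Analysis.Analysis"
begin

text \<open>The circle is the unit circle \<open>sphere 0 1\<close> of the complex plane.  Derivatives and
  integrals of functions on it are taken in the angular parameter \<open>u\<close>, that is, for
  \<open>u \<mapsto> f (cis u)\<close> with \<open>u\<close> in \<open>[0, 2 \<pi>]\<close>.\<close>

definition lift :: "(complex \<Rightarrow> 'a) \<Rightarrow> real \<Rightarrow> 'a" where
  "lift f = (\<lambda>u. f (cis u))"

definition deriv_u :: "(real \<Rightarrow> 'a::real_normed_vector) \<Rightarrow> real \<Rightarrow> 'a" where
  "deriv_u f = (\<lambda>u. vector_derivative f (at u))"

definition smooth :: "(real \<Rightarrow> 'a::real_normed_vector) \<Rightarrow> bool" where
  "smooth f \<longleftrightarrow> (\<forall>n u. (deriv_u ^^ n) f differentiable (at u))"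

definition smooth_closed_immersion :: "(complex \<Rightarrow> real^2) \<Rightarrow> bool" where
  "smooth_closed_immersion \<gamma> \<longleftrightarrow> smooth (lift \<gamma>) \<and> (\<forall>u. deriv_u (lift \<gamma>) u \<noteq> 0)"

definition speed :: "(complex \<Rightarrow> real^2) \<Rightarrow> real \<Rightarrow> real" where
  "speed \<gamma> u = norm (deriv_u (lift \<gamma>) u)"

definition deriv_s :: "(complex \<Rightarrow> real^2) \<Rightarrow> (real \<Rightarrow> 'a::real_normed_vector) \<Rightarrow> real \<Rightarrow> 'a" where
  "deriv_s \<gamma> f = (\<lambda>u. deriv_u f u /\<^sub>R speed \<gamma> u)"

definition integral_ds :: "(complex \<Rightarrow> real^2) \<Rightarrow> (real \<Rightarrow> real) \<Rightarrow> real" where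
  "integral_ds \<gamma> f = integral {0..2 * pi} (\<lambda>u. f u * speed \<gamma> u)"

text \<open>Neither of the two possible orientations of the normal is preferred.\<close>

definition unit_normal_field :: "(complex \<Rightarrow> real^2) \<Rightarrow> (complex \<Rightarrow> real^2) \<Rightarrow> bool" where
  "unit_normal_field \<gamma> \<nu> \<longleftrightarrow>
     continuous_on (sphere 0 1) \<nu> \<and>
     (\<forall>u. norm (lift \<nu> u) = 1 \<and> lift \<nu> u \<bullet> deriv_u (lift \<gamma>) u = 0)"

definition curvature :: "(complex \<Rightarrow> real^2) \<Rightarrow> (complex \<Rightarrow> real^2) \<Rightarrow> real \<Rightarrow> real" where
  "curvature \<gamma> \<nu> u = deriv_s \<gamma> (deriv_s \<gamma> (lift \<gamma>)) u \<bullet> lift \<nu> u"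

definition curve_length :: "(complex \<Rightarrow> real^2) \<Rightarrow> real" where
  "curve_length \<gamma> = integral {0..2 * pi} (speed \<gamma>)"

definition avg_curvature :: "(complex \<Rightarrow> real^2) \<Rightarrow> (complex \<Rightarrow> real^2) \<Rightarrow> real" where
  "avg_curvature \<gamma> \<nu> = 1 / curve_length \<gamma> * integral_ds \<gamma> (curvature \<gamma> \<nu>)"

definition K_osc :: "(complex \<Rightarrow> real^2) \<Rightarrow> (complex \<Rightarrow> real^2) \<Rightarrow> real" where
  "K_osc \<gamma> \<nu> =
     curve_length \<gamma> * integral_ds \<gamma> (\<lambda>u. (curvature \<gamma> \<nu> u - avg_curvature \<gamma> \<nu>)\<^sup>2)"

text \<open>Cardinalities and their supremum are extended naturals, so that neither an infinite
  preimage nor an unbounded supremum is silently sent to an arbitrary natural number.\<close>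

definition ecard :: "'a set \<Rightarrow> enat" where
  "ecard A = (if finite A then enat (card A) else \<infinity>)"

definition max_multiplicity :: "(complex \<Rightarrow> real^2) \<Rightarrow> enat" where
  "max_multiplicity \<gamma> = (SUP x. ecard {z \<in> sphere 0 1. \<gamma> z = x})"

end

theory Submission
  imports Defs
begin

text \<open>
  Write \<open>L\<close> for the length and \<open>E = \<integral> k\<^sup>2 ds\<close>.  Expanding the square gives
  \<open>K_osc = L E - (\<integral> k ds)\<^sup>2 = L E - 4 \<omega>\<^sup>2 \<pi>\<^sup>2\<close>, so the claim is \<open>L E \<ge> 16 m\<^sup>2\<close>.

  A point \<open>p\<close> with \<open>n\<close> preimages cuts the curve into \<open>n\<close> loops based at \<open>p\<close>, and the heart of the
  matter is that each loop, of length \<open>l\<close> and energy \<open>e = \<integral> k\<^sup>2 ds\<close>, has \<open>l e \<ge> 16\<close>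
  (\<open>loop_length_energy_bound\<close>).  With \<open>y = \<gamma> - p\<close>, the cosine
  \<open>T \<bullet> y / |y|\<close> of the angle between tangent and position falls from \<open>1\<close> to \<open>-1\<close>
  along the loop, while completing a square in its derivative
  \<open>k (\<nu> \<bullet> y) / |y| + (\<nu> \<bullet> y)\<^sup>2 / |y|\<^sup>3\<close> bounds it below by \<open>- k\<^sup>2 |y| / 4\<close>.
  Hence \<open>\<integral> k\<^sup>2 |y| ds \<ge> 8\<close>, and \<open>|y| \<le> l / 2\<close> because every point of the loop is within
  arc-length \<open>l / 2\<close> of one of its ends.

  To avoid the singularity at \<open>y = 0\<close>, which a loop may also meet in its interior, \<open>|y|\<close> is
  replaced by \<open>sqrt (|y|\<^sup>2 + \<delta>)\<close>.  The regularised cosine vanishes at both ends, but its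
  derivative gains the term \<open>\<delta> / (|y|\<^sup>2 + \<delta>)\<^bsup>3/2\<^esup>\<close>; comparing \<open>|y|\<close> with the arc-length
  \<open>\<sigma>\<close> to the nearer end, the integral of this term over each half is at least the increment of
  \<open>\<sigma> / sqrt (\<sigma>\<^sup>2 + \<delta>)\<close>, which tends to \<open>1\<close> as \<open>\<delta> \<rightarrow> 0\<close> and so recovers the jump
  from \<open>1\<close> to \<open>-1\<close>.

  The loops are glued by linearising: \<open>l e \<ge> 16\<close> gives \<open>e + c\<^sup>2 l \<ge> 8 c\<close> for every \<open>c \<ge> 0\<close>,
  which is additive over the loops and yields \<open>E + c\<^sup>2 L \<ge> 8 c n\<close>; now take \<open>c = 4 n / L\<close>
  (\<open>multiplicity_bound\<close>).  The bound on \<open>n\<close> also shows that the multiplicity is finite.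
\<close>

section \<open>The length and energy of a loop\<close>

text \<open>Write \<open>n\<close> for the part of \<open>y\<close> normal to \<open>T\<close>.  The last two terms on the right make
  \<open>\<delta> / R\<^sup>3 + |n|\<^sup>2 / R\<^sup>3\<close>, and \<open>|n|\<^sup>2 / R\<^sup>3 - |\<kappa>| |n| / R + R |\<kappa>|\<^sup>2 / 4\<close> is a square.\<close>

lemma radial_derivative_bound:
  fixes T \<kappa> y :: "'a::real_inner" and \<sigma> \<delta> M :: real
  assumes T: "norm T = 1" and orth: "\<kappa> \<bullet> T = 0" and \<delta>: "\<delta> > 0"
    and y: "norm y \<le> \<bar>\<sigma>\<bar>" and M: "sqrt ((norm y)\<^sup>2 + \<delta>) \<le> M"
  defines "R \<equiv> sqrt ((norm y)\<^sup>2 + \<delta>)"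
  shows "\<delta> / sqrt (\<sigma>\<^sup>2 + \<delta>) ^ 3 - M / 4 * (norm \<kappa>)\<^sup>2
           \<le> (\<kappa> \<bullet> y) / R + 1 / R - (T \<bullet> y)\<^sup>2 / R ^ 3"
proof -
  define n where "n = y - (T \<bullet> y) *\<^sub>R T"
  have R: "R > 0" "R\<^sup>2 = (norm y)\<^sup>2 + \<delta>"
    using \<delta> by (auto simp: R_def add_nonneg_pos)
  have TT: "T \<bullet> T = 1"
    using T by (simp add: dot_square_norm)
  have n2: "(norm n)\<^sup>2 = (norm y)\<^sup>2 - (T \<bullet> y)\<^sup>2"
    unfolding power2_norm_eq_inner n_def
    by (simp add: inner_diff inner_commute TT power2_eq_square)
  have "R \<le> sqrt (\<sigma>\<^sup>2 + \<delta>)"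
    unfolding R_def using y by (simp add: abs_le_square_iff [symmetric])
  then have "\<delta> / sqrt (\<sigma>\<^sup>2 + \<delta>) ^ 3 \<le> \<delta> / R ^ 3"
    using R \<delta> by (intro divide_left_mono power_mono mult_pos_pos zero_less_power) (auto simp: add_nonneg_pos)
  moreover have "R / 4 * (norm \<kappa>)\<^sup>2 \<le> M / 4 * (norm \<kappa>)\<^sup>2"
    using M by (intro mult_right_mono) (auto simp: R_def)
  moreover have "\<kappa> \<bullet> y = \<kappa> \<bullet> n"
    using orth by (simp add: n_def inner_diff_right)
  then have "\<kappa> \<bullet> y \<ge> - (norm \<kappa> * norm n)"
    using Cauchy_Schwarz_ineq2 [of \<kappa> n] by linarith
  then have "(\<kappa> \<bullet> y) / R \<ge> - (norm \<kappa> * norm n) / R"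
    using R by (intro divide_right_mono) auto
  moreover have "1 / R - (T \<bullet> y)\<^sup>2 / R ^ 3 - \<delta> / R ^ 3 = (norm n)\<^sup>2 / R ^ 3"
  proof -
    have "1 / R = R\<^sup>2 / R ^ 3"
      using R(1) by (simp add: power2_eq_square power3_eq_cube)
    then show ?thesis
      unfolding n2 R(2) by (simp add: diff_divide_distrib add_divide_distrib)
  qed
  moreover have "0 \<le> (norm n)\<^sup>2 / R ^ 3 - norm \<kappa> * norm n / R + R / 4 * (norm \<kappa>)\<^sup>2"
  proof -
    have "(norm n)\<^sup>2 / R ^ 3 - norm \<kappa> * norm n / R + R / 4 * (norm \<kappa>)\<^sup>2
        = (norm n - norm \<kappa> * R\<^sup>2 / 2)\<^sup>2 / R ^ 3"
      using R(1) by (simp add: field_simps power2_eq_square power3_eq_cube)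
    then show ?thesis
      using R(1) by simp
  qed
  ultimately show ?thesis
    by simp
qed

lemma deriv_div_sqrt:
  assumes "(S has_real_derivative v) (at u)" "\<delta> > 0"
  shows "((\<lambda>u. S u / sqrt ((S u)\<^sup>2 + \<delta>)) has_real_derivative v * (\<delta> / sqrt ((S u)\<^sup>2 + \<delta>) ^ 3)) (at u)"
proof -
  have q: "(S u)\<^sup>2 + \<delta> > 0" using assms(2) by (simp add: add_nonneg_pos)
  define q where "q = sqrt ((S u)\<^sup>2 + \<delta>)"
  have q': "q > 0" "q\<^sup>2 = (S u)\<^sup>2 + \<delta>" using q by (auto simp: q_def)
  have "((\<lambda>u. S u / sqrt ((S u)\<^sup>2 + \<delta>)) has_real_derivative
      (v * q - S u * (2 * S u * v * (inverse q / 2))) / (q * q)) (at u)"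
    unfolding q_def using q
    by (auto intro!: derivative_eq_intros assms(1) simp: ac_simps)
  moreover have "(v * q - S u * (2 * S u * v * (inverse q / 2))) / (q * q) = v * ((q\<^sup>2 - (S u)\<^sup>2) / q ^ 3)"
    using q'(1) by (simp add: field_simps power2_eq_square power3_eq_cube)
  ultimately show ?thesis
    using q' by (simp add: q_def)
qed

lemma deriv_radial:
  fixes \<gamma> T :: "real \<Rightarrow> 'a::real_inner" and \<kappa> p :: 'a
  assumes \<gamma>: "(\<gamma> has_vector_derivative v *\<^sub>R T u) (at u)"
    and T: "(T has_vector_derivative v *\<^sub>R \<kappa>) (at u)" "norm (T u) = 1" and \<delta>: "\<delta> > 0"
  defines "R \<equiv> \<lambda>u. sqrt ((norm (\<gamma> u - p))\<^sup>2 + \<delta>)"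
  shows "((\<lambda>u. T u \<bullet> (\<gamma> u - p) / R u) has_real_derivative
     v * ((\<kappa> \<bullet> (\<gamma> u - p)) / R u + 1 / R u - (T u \<bullet> (\<gamma> u - p))\<^sup>2 / R u ^ 3)) (at u)"
proof -
  have R: "R u > 0" "(norm (\<gamma> u - p))\<^sup>2 + \<delta> > 0"
    using \<delta> by (auto simp: R_def add_nonneg_pos)
  have TT: "T u \<bullet> T u = 1"
    using T by (simp add: dot_square_norm)
  have y: "((\<lambda>u. \<gamma> u - p) has_vector_derivative v *\<^sub>R T u) (at u)"
    using has_vector_derivative_diff [OF \<gamma> has_vector_derivative_const [of p]] by simp
  have num: "((\<lambda>u. T u \<bullet> (\<gamma> u - p)) has_real_derivative v * (\<kappa> \<bullet> (\<gamma> u - p)) + v) (at u)"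
    using bounded_bilinear.has_vector_derivative [OF bounded_bilinear_inner T(1) y]
    by (simp add: has_real_derivative_iff_has_vector_derivative TT ac_simps)
  have sq: "((\<lambda>u. (norm (\<gamma> u - p))\<^sup>2) has_real_derivative 2 * v * (T u \<bullet> (\<gamma> u - p))) (at u)"
    using bounded_bilinear.has_vector_derivative [OF bounded_bilinear_inner y y]
    by (simp add: has_real_derivative_iff_has_vector_derivative power2_norm_eq_inner inner_commute mult.assoc)
  have DR: "(R has_real_derivative 2 * v * (T u \<bullet> (\<gamma> u - p)) * (inverse (R u) / 2)) (at u)"
    unfolding R_def
    using DERIV_chain2 [OF DERIV_real_sqrt [OF R(2)] DERIV_add [OF sq DERIV_const [of \<delta>]]]
    by (simp add: ac_simps)
  have "((\<lambda>u. T u \<bullet> (\<gamma> u - p) / R u) has_real_derivative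
      ((v * (\<kappa> \<bullet> (\<gamma> u - p)) + v) * R u -
        T u \<bullet> (\<gamma> u - p) * (2 * v * (T u \<bullet> (\<gamma> u - p)) * (inverse (R u) / 2))) / (R u * R u)) (at u)"
    using R(1) by (intro DERIV_divide num DR) simp
  then show ?thesis
    by (rule DERIV_cong) (use R(1) in \<open>simp add: field_simps power2_eq_square power3_eq_cube\<close>)
qed

text \<open>The regularised cosine is compared with the profile \<open>g\<close> that it has on a straight line
  through \<open>p\<close>.
  The function \<open>S\<close> is a signed arc-length measured from a point where the curve meets \<open>p\<close>, so it is
  allowed to be negative: the second half of a loop is measured from its final end.\<close>

lemma radial_increase_bound:
  fixes \<gamma> T \<kappa> :: "real \<Rightarrow> 'a::real_inner" and p :: 'a
  assumes "a \<le> b" and \<delta>: "\<delta> > 0"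
    and \<gamma>: "\<And>u. u \<in> {a..b} \<Longrightarrow> (\<gamma> has_vector_derivative v u *\<^sub>R T u) (at u)"
    and T: "\<And>u. u \<in> {a..b} \<Longrightarrow> (T has_vector_derivative v u *\<^sub>R \<kappa> u) (at u)"
    and unit: "\<And>u. u \<in> {a..b} \<Longrightarrow> norm (T u) = 1"
    and orth: "\<And>u. u \<in> {a..b} \<Longrightarrow> \<kappa> u \<bullet> T u = 0"
    and v: "\<And>u. u \<in> {a..b} \<Longrightarrow> v u \<ge> 0"
    and S: "\<And>u. u \<in> {a..b} \<Longrightarrow> (S has_real_derivative v u) (at u)"
    and W: "\<And>u. u \<in> {a..b} \<Longrightarrow> (W has_real_derivative v u * (norm (\<kappa> u))\<^sup>2) (at u)"
    and near: "\<And>u. u \<in> {a..b} \<Longrightarrow> norm (\<gamma> u - p) \<le> \<bar>S u\<bar>"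
    and h: "\<And>u. u \<in> {a..b} \<Longrightarrow> \<bar>S u\<bar> \<le> h"
  defines "f \<equiv> \<lambda>u. T u \<bullet> (\<gamma> u - p) / sqrt ((norm (\<gamma> u - p))\<^sup>2 + \<delta>)"
  defines "g \<equiv> \<lambda>u. S u / sqrt ((S u)\<^sup>2 + \<delta>)"
  shows "g b - g a - sqrt (h\<^sup>2 + \<delta>) / 4 * (W b - W a) \<le> f b - f a"
proof -
  define M where "M = sqrt (h\<^sup>2 + \<delta>)"
  define F where "F = (\<lambda>u. f u - g u + M / 4 * W u)"
  have "F a \<le> F b"
  proof (rule DERIV_nonneg_imp_nondecreasing [OF \<open>a \<le> b\<close>])
    fix u assume u: "a \<le> u" "u \<le> b"
    then have u': "u \<in> {a..b}" by simp
    define R where "R = sqrt ((norm (\<gamma> u - p))\<^sup>2 + \<delta>)"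
    let ?f' = "(\<kappa> u \<bullet> (\<gamma> u - p)) / R + 1 / R - (T u \<bullet> (\<gamma> u - p))\<^sup>2 / R ^ 3"
    let ?D = "v u * ?f' - v u * (\<delta> / sqrt ((S u)\<^sup>2 + \<delta>) ^ 3) + M / 4 * (v u * (norm (\<kappa> u))\<^sup>2)"
    have "(F has_real_derivative ?D) (at u)"
      unfolding F_def f_def g_def R_def
      by (intro DERIV_add DERIV_diff DERIV_cmult deriv_radial deriv_div_sqrt \<gamma> T S W unit u' \<delta>)
    moreover have "norm (\<gamma> u - p) \<le> h"
      using near [OF u'] h [OF u'] by linarith
    then have "R \<le> M"
      by (simp add: M_def R_def power_mono)
    then have "\<delta> / sqrt ((S u)\<^sup>2 + \<delta>) ^ 3 - M / 4 * (norm (\<kappa> u))\<^sup>2 \<le> ?f'"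
      unfolding R_def using unit orth near u' \<delta> by (intro radial_derivative_bound) auto
    then have "0 \<le> v u * (?f' - (\<delta> / sqrt ((S u)\<^sup>2 + \<delta>) ^ 3 - M / 4 * (norm (\<kappa> u))\<^sup>2))"
      using v [OF u'] by (intro mult_nonneg_nonneg) auto
    then have "?D \<ge> 0"
      by (simp add: algebra_simps)
    ultimately show "\<exists>y. (F has_real_derivative y) (at u) \<and> y \<ge> 0"
      by blast
  qed
  then show ?thesis
    by (simp add: F_def M_def right_diff_distrib)
qed

lemma norm_diff_le_arclength:
  fixes \<gamma> T :: "real \<Rightarrow> 'a::real_inner"
  assumes "a \<le> b"
    and \<gamma>: "\<And>u. u \<in> {a..b} \<Longrightarrow> (\<gamma> has_vector_derivative v u *\<^sub>R T u) (at u)"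
    and unit: "\<And>u. u \<in> {a..b} \<Longrightarrow> norm (T u) = 1"
    and v: "\<And>u. u \<in> {a..b} \<Longrightarrow> v u \<ge> 0"
    and S: "\<And>u. u \<in> {a..b} \<Longrightarrow> (S has_real_derivative v u) (at u)"
  shows "norm (\<gamma> b - \<gamma> a) \<le> S b - S a"
proof (cases "a = b")
  case False
  show ?thesis
  proof (rule differentiable_bound_general [where f = \<gamma> and \<phi> = S and f' = "\<lambda>u. v u *\<^sub>R T u" and \<phi>' = v])
    show "a < b" using False assms(1) by simp
    show "continuous_on {a..b} \<gamma>"
      by (intro continuous_at_imp_continuous_on ballI has_vector_derivative_continuous [OF \<gamma>])
    show "continuous_on {a..b} S"
      by (intro continuous_at_imp_continuous_on ballI DERIV_continuous [OF S])
  qed (use \<gamma> S unit v in \<open>auto simp: has_real_derivative_iff_has_vector_derivative\<close>)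
qed simp

lemma continuous_antiderivative:
  fixes f :: "real \<Rightarrow> real"
  assumes "\<And>u. isCont f u"
  shows "\<exists>F. \<forall>u\<in>{a..b}. (F has_real_derivative f u) (at u)"
proof (intro exI ballI)
  fix u assume u: "u \<in> {a..b}"
  \<comment> \<open>A margin of \<open>1\<close> on both sides makes the derivatives at \<open>a\<close> and \<open>b\<close> two-sided.\<close>
  have "((\<lambda>u. integral {a - 1..u} f) has_real_derivative f u) (at u within {a - 1..b + 1})"
    using u assms by (intro integral_has_real_derivative continuous_at_imp_continuous_on) auto
  then show "((\<lambda>u. integral {a - 1..u} f) has_real_derivative f u) (at u)"
    using u by (subst (asm) at_within_Icc_at) auto
qed

lemma integral_eq_antiderivative_diff:
  fixes f :: "real \<Rightarrow> real"
  assumes "a \<le> b" and F: "\<And>u. u \<in> {a..b} \<Longrightarrow> (F has_real_derivative f u) (at u)"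
  shows "integral {a..b} f = F b - F a"
proof (intro integral_unique fundamental_theorem_of_calculus assms(1))
  fix u assume "u \<in> {a..b}"
  then show "(F has_vector_derivative f u) (at u within {a..b})"
    using has_field_derivative_at_within [OF F]
    by (simp add: has_real_derivative_iff_has_vector_derivative)
qed

text \<open>The regularised cosine \<open>f\<close> vanishes at both ends, so the lower bounds for its increments over
  the two halves of equal length add up to a nonpositive number.  Each half contributes \<open>h / M\<close> with
  \<open>2 h\<close> the length of the loop and \<open>M = sqrt (h\<^sup>2 + \<delta>)\<close>, and the energy enters with the factor
  \<open>M / 4\<close>; clearing denominators leaves a bound that survives \<open>\<delta> \<rightarrow> 0\<close>.\<close>

lemma loop_length_energy_bound:
  fixes \<gamma> T \<kappa> :: "real \<Rightarrow> 'a::real_inner"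
  assumes ab: "a < b" and loop: "\<gamma> a = \<gamma> b"
    and \<gamma>: "\<And>u. (\<gamma> has_vector_derivative v u *\<^sub>R T u) (at u)"
    and T: "\<And>u. (T has_vector_derivative v u *\<^sub>R \<kappa> u) (at u)"
    and unit: "\<And>u. norm (T u) = 1"
    and orth: "\<And>u. \<kappa> u \<bullet> T u = 0"
    and v: "\<And>u. v u > 0" "\<And>u. isCont v u"
    and \<kappa>: "\<And>u. isCont \<kappa> u"
  shows "16 \<le> integral {a..b} v * integral {a..b} (\<lambda>u. v u * (norm (\<kappa> u))\<^sup>2)"
proof -
  obtain S where "\<forall>u\<in>{a..b}. (S has_real_derivative v u) (at u)"
    using continuous_antiderivative [OF v(2)] ..
  note S = bspec [OF this]
  have isCont_W: "isCont (\<lambda>u. v u * (norm (\<kappa> u))\<^sup>2) u" for u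
    by (intro continuous_intros v \<kappa>)
  obtain W where "\<forall>u\<in>{a..b}. (W has_real_derivative v u * (norm (\<kappa> u))\<^sup>2) (at u)"
    using continuous_antiderivative [OF isCont_W] ..
  note W = bspec [OF this]
  have IS: "integral {a..b} v = S b - S a"
    using ab S by (intro integral_eq_antiderivative_diff) auto
  have IW: "integral {a..b} (\<lambda>u. v u * (norm (\<kappa> u))\<^sup>2) = W b - W a"
    using ab W by (intro integral_eq_antiderivative_diff) auto
  define h where "h = (S b - S a) / 2"
  define E where "E = W b - W a"
  have incr: "S x < S y" if "a \<le> x" "x < y" "y \<le> b" for x y
  proof (rule DERIV_pos_imp_increasing [OF that(2)])
    fix u assume "x \<le> u" "u \<le> y"
    then show "\<exists>D. (S has_real_derivative D) (at u) \<and> D > 0"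
      using that S [of u] v(1) [of u] by auto
  qed
  have mono: "S x \<le> S y" if "a \<le> x" "x \<le> y" "y \<le> b" for x y
    using incr [of x y] that by (cases "x = y") auto
  have h: "h > 0" using incr [of a b] ab by (simp add: h_def)
  have "continuous_on {a..b} S"
    by (intro continuous_at_imp_continuous_on ballI DERIV_continuous [OF S])
  then obtain c where c: "a \<le> c" "c \<le> b" "S c = S a + h"
    using IVT' [of S a "S a + h" b] ab h by (auto simp: h_def field_simps)
  have Sb: "S b = S a + 2 * h" by (simp add: h_def field_simps)
  have key: "4 * (2 * h) \<le> E * (h\<^sup>2 + \<delta>)" if \<delta>: "\<delta> > 0" for \<delta>
  proof -
    define f where "f = (\<lambda>u. T u \<bullet> (\<gamma> u - \<gamma> a) / sqrt ((norm (\<gamma> u - \<gamma> a))\<^sup>2 + \<delta>))"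
    define M where "M = sqrt (h\<^sup>2 + \<delta>)"
    have M: "M > 0" "M\<^sup>2 = h\<^sup>2 + \<delta>" using \<delta> by (auto simp: M_def add_nonneg_pos)
    have DS: "((\<lambda>u. S u - r) has_real_derivative v u) (at u)" if "u \<in> {a..b}" for r u
      using DERIV_diff [OF S [OF that] DERIV_const [of r]] by simp
    have "h / M - M / 4 * (W c - W a) \<le> f c - f a"
    proof -
      have "norm (\<gamma> u - \<gamma> a) \<le> \<bar>S u - S a\<bar>" if "u \<in> {a..c}" for u
      proof -
        have "norm (\<gamma> u - \<gamma> a) \<le> S u - S a"
          using c that by (intro norm_diff_le_arclength [OF _ \<gamma> unit less_imp_le [OF v(1)] S]) auto
        then show ?thesis by linarith
      qed
      moreover have "\<bar>S u - S a\<bar> \<le> h" if "u \<in> {a..c}" for u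
        using mono [of a u] mono [of u c] that c by auto
      ultimately have "(S c - S a) / sqrt ((S c - S a)\<^sup>2 + \<delta>) - (S a - S a) / sqrt ((S a - S a)\<^sup>2 + \<delta>)
          - sqrt (h\<^sup>2 + \<delta>) / 4 * (W c - W a) \<le> f c - f a"
        unfolding f_def using c
        by (intro radial_increase_bound [where \<kappa> = \<kappa> and v = v and h = h] \<gamma> T unit orth DS W
              \<delta> less_imp_le [OF v(1)]) auto
      then show ?thesis
        using c by (simp add: M_def)
    qed
    moreover have "h / M - M / 4 * (W b - W c) \<le> f b - f c"
    proof -
      have "norm (\<gamma> u - \<gamma> a) \<le> \<bar>S u - S b\<bar>" if "u \<in> {c..b}" for u
      proof -
        have "norm (\<gamma> b - \<gamma> u) \<le> S b - S u"
          using c that by (intro norm_diff_le_arclength [OF _ \<gamma> unit less_imp_le [OF v(1)] S]) auto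
        then show ?thesis
          unfolding loop by (simp add: norm_minus_commute)
      qed
      moreover have "\<bar>S u - S b\<bar> \<le> h" if "u \<in> {c..b}" for u
        using mono [of c u] mono [of u b] that c Sb by auto
      ultimately have "(S b - S b) / sqrt ((S b - S b)\<^sup>2 + \<delta>) - (S c - S b) / sqrt ((S c - S b)\<^sup>2 + \<delta>)
          - sqrt (h\<^sup>2 + \<delta>) / 4 * (W b - W c) \<le> f b - f c"
        unfolding f_def using c
        by (intro radial_increase_bound [where \<kappa> = \<kappa> and v = v and h = h] \<gamma> T unit orth DS W
              \<delta> less_imp_le [OF v(1)]) auto
      then show ?thesis
        using c Sb by (simp add: M_def)
    qed
    moreover have "f a = 0" "f b = 0"
      by (simp_all add: f_def loop)
    ultimately have "2 * (h / M) \<le> M / 4 * (W c - W a) + M / 4 * (W b - W c)"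
      by linarith
    also have "\<dots> = M / 4 * E"
      by (simp add: E_def right_diff_distrib)
    finally have "2 * (h / M) \<le> M / 4 * E" .
    then have "2 * (h / M) * (4 * M) \<le> M / 4 * E * (4 * M)"
      using M(1) by (intro mult_right_mono) auto
    then have "4 * (2 * h) \<le> E * M\<^sup>2"
      using M(1) by (simp add: power2_eq_square ac_simps)
    then show ?thesis using M by simp
  qed
  have "((\<lambda>\<delta>. E * (h\<^sup>2 + \<delta>)) \<longlongrightarrow> E * (h\<^sup>2 + 0)) (at_right 0)"
    by (intro tendsto_intros)
  moreover have "\<forall>\<^sub>F \<delta> in at_right 0. 4 * (2 * h) \<le> E * (h\<^sup>2 + \<delta>)"
    using eventually_at_right_less by (rule eventually_mono) (rule key)
  ultimately have "4 * (2 * h) \<le> E * (h\<^sup>2 + 0)"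
    by (rule tendsto_lowerbound) simp
  then have "16 * h \<le> (2 * h * E) * h"
    by (simp add: power2_eq_square algebra_simps)
  then show ?thesis
    unfolding IS IW using h by (simp add: Sb E_def)
qed

section \<open>Cutting a periodic curve into loops\<close>

lemma vector_derivative_periodic:
  fixes f :: "real \<Rightarrow> 'a::real_normed_vector"
  assumes per: "\<And>u. f (u + P) = f u"
  shows "vector_derivative f (at (u + P)) = vector_derivative f (at u)"
proof -
  have shift: "(g has_vector_derivative D) (at x)"
    if "(g has_vector_derivative D) (at (x + c))" "\<And>u. g (u + c) = g u" for g :: "real \<Rightarrow> 'a" and D x c
  proof -
    have "((\<lambda>x. x + c) has_vector_derivative 1) (at x)"
      by (auto intro!: derivative_eq_intros)
    from vector_diff_chain_at [OF this that(1)] show ?thesis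
      using that(2) by (simp add: o_def)
  qed
  have "f (v + - P) = f v" for v
    using per [of "v - P"] by simp
  then have "(f has_vector_derivative D) (at (u + P)) \<longleftrightarrow> (f has_vector_derivative D) (at u)" for D
    using shift [of f D u P] shift [of f D "u + P" "- P"] per by auto
  then show ?thesis
    by (simp add: vector_derivative_def)
qed

lemma integral_periodic_offset:
  fixes f :: "real \<Rightarrow> real"
  assumes per: "\<And>u. f (u + P) = f u" and cont: "\<And>u. isCont f u" and "0 \<le> t" "0 \<le> P"
  shows "integral {t..t + P} f = integral {0..P} f"
proof -
  have int: "f integrable_on {a..b}" for a b
    by (intro integrable_continuous_real continuous_at_imp_continuous_on ballI cont)
  have "integral {0..t} f + integral {t..t + P} f = integral {0..t + P} f"
    using assms int by (intro Henstock_Kurzweil_Integration.integral_combine) auto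
  moreover have "integral {0..P} f + integral {P..t + P} f = integral {0..t + P} f"
    using assms int by (intro Henstock_Kurzweil_Integration.integral_combine) auto
  moreover have "integral {P..t + P} f = integral {0..t} f"
    using integral_shift_Icc_real [of 0 t f P] per by (simp add: o_def add.commute)
  ultimately show ?thesis by simp
qed

text \<open>The gaps between consecutive elements of \<open>A\<close> telescope.\<close>

lemma sum_of_gaps_le:
  fixes G :: "real \<Rightarrow> real"
  assumes "finite A" "A \<noteq> {}" "\<And>x y. x \<in> A \<Longrightarrow> y \<in> A \<Longrightarrow> x < y \<Longrightarrow> d \<le> G y - G x"
  shows "d * (real (card A) - 1) \<le> G (Max A) - G (Min A)"
  using assms
proof (induction rule: finite_linorder_max_induct)
  case (insert b A)
  show ?case
  proof (cases "A = {}")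
    case False
    then have M: "Max A \<in> A" "Min A \<in> A" using insert.hyps by auto
    have b: "b \<notin> A" "Max A < b" "Min A < b"
      using insert.hyps M by auto
    have "Max (insert b A) = b"
      using insert.hyps(1) False b by (simp add: max.absorb1)
    moreover have "Min (insert b A) = Min A"
      using insert.hyps(1) False b by (simp add: min.absorb2)
    moreover have "d * (real (card A) - 1) \<le> G (Max A) - G (Min A)"
      using insert False by auto
    moreover have "d \<le> G b - G (Max A)"
      using insert.prems b M by auto
    moreover have "real (card (insert b A)) - 1 = real (card A) - 1 + 1"
      using insert.hyps b by simp
    ultimately show ?thesis
      by (simp only: distrib_left)
  qed simp
qed simp

text \<open>The parameters in \<open>A\<close>, followed by one period after the first of them, are \<open>card A + 1\<close>
  parameters of the same point.  Their gaps are measured by \<open>G\<close>, which combines energy and length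
  with the weight \<open>c\<^sup>2\<close> that makes the resulting bound optimal.\<close>

lemma multiplicity_bound:
  fixes \<gamma> T \<kappa> :: "real \<Rightarrow> 'a::real_inner"
  assumes per: "\<And>u. \<gamma> (u + P) = \<gamma> u" "\<And>u. v (u + P) = v u" "\<And>u. \<kappa> (u + P) = \<kappa> u"
    and \<gamma>: "\<And>u. (\<gamma> has_vector_derivative v u *\<^sub>R T u) (at u)"
    and T: "\<And>u. (T has_vector_derivative v u *\<^sub>R \<kappa> u) (at u)"
    and unit: "\<And>u. norm (T u) = 1"
    and orth: "\<And>u. \<kappa> u \<bullet> T u = 0"
    and v: "\<And>u. v u > 0" "\<And>u. isCont v u"
    and \<kappa>: "\<And>u. isCont \<kappa> u"
    and A: "finite A" "A \<subseteq> {0..<P}" "\<And>u. u \<in> A \<Longrightarrow> \<gamma> u = x"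
  shows "16 * (real (card A))\<^sup>2
    \<le> integral {0..P} v * integral {0..P} (\<lambda>u. v u * (norm (\<kappa> u))\<^sup>2)"
proof -
  define w where "w = (\<lambda>u. v u * (norm (\<kappa> u))\<^sup>2)"
  have w: "isCont w u" "w u \<ge> 0" "w (u + P) = w u" for u
    unfolding w_def using v(1) [of u] by (auto intro!: continuous_intros v \<kappa> simp: per)
  have int: "v integrable_on {a..b}" "w integrable_on {a..b}" for a b
    by (intro integrable_continuous_real continuous_at_imp_continuous_on ballI v w)+
  define L where "L = integral {0..P} v"
  define E where "E = integral {0..P} w"
  have LE: "L \<ge> 0" "E \<ge> 0"
    unfolding L_def E_def using less_imp_le [OF v(1)] w(2) int by (auto intro!: integral_nonneg)
  have "16 * (real (card A))\<^sup>2 \<le> L * E"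
  proof (cases "A = {}")
    case False
    define n where "n = real (card A)"
    define t where "t = Min A"
    define B where "B = insert (t + P) A"
    have "t \<in> A"
      using A False by (simp add: t_def)
    with A(2) have t: "t \<in> A" "0 \<le> t" "t < P"
      by auto
    then have P: "P > 0" by simp
    have above: "u < t + P" if "u \<in> A" for u
      using A(2) that t by force
    have B: "finite B" "B \<noteq> {}" "Max B = t + P" "Min B = t" "real (card B) - 1 = n"
    proof -
      show "finite B" "B \<noteq> {}" using A by (auto simp: B_def)
      show "Max B = t + P" using A above by (intro Max_eqI) (auto simp: B_def less_imp_le)
      show "Min B = t" using A t P by (intro Min_eqI) (auto simp: B_def t_def)
      have "t + P \<notin> A" using above by blast
      then show "real (card B) - 1 = n" using A by (simp add: B_def n_def)
    qed
    have \<gamma>B: "\<gamma> u = x" "u \<ge> 0" if "u \<in> B" for u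
      using that A t per(1) by (auto simp: B_def)
    have loop: "16 \<le> integral {a..b} v * integral {a..b} w" if "a \<in> B" "b \<in> B" "a < b" for a b
      unfolding w_def using \<gamma>B(1) that by (intro loop_length_energy_bound [OF _ _ \<gamma> T unit orth v \<kappa>]) auto
    \<comment> \<open>The whole curve is itself a loop, which excludes \<open>L = 0\<close>.\<close>
    have "16 \<le> L * E"
      using loop [of t "t + P"] t P v(2) w per
      by (simp add: B_def L_def E_def integral_periodic_offset)
    then have L: "L > 0"
      using LE by (cases "L = 0") auto
    define c where "c = 4 * n / L"
    define G where "G = (\<lambda>u. integral {0..u} w + c\<^sup>2 * integral {0..u} v)"
    have G_diff: "G b - G a = integral {a..b} w + c\<^sup>2 * integral {a..b} v" if "0 \<le> a" "a \<le> b" for a b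
    proof -
      have v_diff: "integral {a..b} v = integral {0..b} v - integral {0..a} v"
        using Henstock_Kurzweil_Integration.integral_combine [OF that int(1)] by linarith
      have w_diff: "integral {a..b} w = integral {0..b} w - integral {0..a} w"
        using Henstock_Kurzweil_Integration.integral_combine [OF that int(2)] by linarith
      show ?thesis
        unfolding G_def v_diff w_diff by (simp only: right_diff_distrib)
    qed
    have gap: "8 * c \<le> G b - G a" if "a \<in> B" "b \<in> B" "a < b" for a b
    proof -
      define l where "l = integral {a..b} v"
      define e where "e = integral {a..b} w"
      have le: "16 \<le> l * e" using loop [OF that] by (simp add: l_def e_def)
      have "l \<ge> 0" unfolding l_def using less_imp_le [OF v(1)] int by (auto intro!: integral_nonneg)
      then have "l > 0" using le by (cases "l = 0") auto
      have "(c * l - 4)\<^sup>2 \<ge> 0" by simp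
      then have "l * (8 * c) \<le> 16 + c\<^sup>2 * l\<^sup>2"
        by (simp add: power2_eq_square algebra_simps)
      also have "\<dots> \<le> l * (e + c\<^sup>2 * l)"
        using le by (simp add: power2_eq_square algebra_simps)
      finally have "8 * c \<le> e + c\<^sup>2 * l"
        using \<open>l > 0\<close> by simp
      then show ?thesis
        using G_diff that \<gamma>B(2) by (simp add: e_def l_def)
    qed
    have "8 * c * n \<le> G (t + P) - G t"
      using sum_of_gaps_le [of B "8 * c" G] B gap by simp
    also have "\<dots> = E + c\<^sup>2 * L"
      using G_diff [of t "t + P"] t P v(2) w per
      by (simp add: L_def E_def integral_periodic_offset)
    finally have "L * (8 * c * n) \<le> L * (E + c\<^sup>2 * L)"
      using L by simp
    moreover have "L * (8 * c * n) = 8 * (c * L) * n" "L * (E + c\<^sup>2 * L) = L * E + (c * L)\<^sup>2"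
      by algebra+
    moreover have "c * L = 4 * n"
      using L by (simp add: c_def)
    ultimately have "32 * n\<^sup>2 \<le> L * E + 16 * n\<^sup>2"
      by (simp add: power2_eq_square)
    then show ?thesis by (simp add: n_def)
  qed (use LE in simp)
  then show ?thesis by (simp add: L_def E_def w_def)
qed

section \<open>Plane curves\<close>

lemma unit_vector_derivative:
  fixes g :: "real \<Rightarrow> 'a::real_inner"
  assumes g: "(g has_vector_derivative D) (at u)" and nz: "g u \<noteq> 0"
  shows "((\<lambda>u. g u /\<^sub>R norm (g u)) has_vector_derivative
           (D /\<^sub>R norm (g u) - ((g u \<bullet> D) / norm (g u) ^ 3) *\<^sub>R g u)) (at u)"
proof -
  have "((\<lambda>u. g u \<bullet> g u) has_real_derivative 2 * (g u \<bullet> D)) (at u)"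
    using bounded_bilinear.has_vector_derivative [OF bounded_bilinear_inner g g]
    by (simp add: has_real_derivative_iff_has_vector_derivative inner_commute)
  from DERIV_chain2 [OF DERIV_real_sqrt this] nz
  have "((\<lambda>u. norm (g u)) has_real_derivative (g u \<bullet> D) / norm (g u)) (at u)"
    by (simp add: norm_eq_sqrt_inner [symmetric] divide_simps)
  from DERIV_inverse' [OF this] nz
  have "((\<lambda>u. inverse (norm (g u))) has_real_derivative - ((g u \<bullet> D) / norm (g u) ^ 3)) (at u)"
    by (simp add: power3_eq_cube field_simps)
  from has_vector_derivative_scaleR [OF this g] show ?thesis
    by (simp add: ac_simps)
qed

text \<open>In the plane, the curvature vector is a multiple of \<open>\<nu>\<close>, so its length is the absolute value
  of the scalar curvature whichever orientation \<open>\<nu>\<close> has.\<close>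

lemma plane_norm_eq_normal_component:
  fixes \<kappa> \<nu> \<tau> :: "real^2"
  assumes "norm \<nu> = 1" "\<nu> \<bullet> \<tau> = 0" "\<kappa> \<bullet> \<tau> = 0" "\<tau> \<noteq> 0"
  shows "(norm \<kappa>)\<^sup>2 = (\<kappa> \<bullet> \<nu>)\<^sup>2"
proof -
  have \<nu>: "\<nu>$1 * \<nu>$1 + \<nu>$2 * \<nu>$2 = 1"
    using assms(1) by (simp add: norm_eq_1 inner_vec_def sum_2)
  have o: "\<nu>$1 * \<tau>$1 + \<nu>$2 * \<tau>$2 = 0" "\<kappa>$1 * \<tau>$1 + \<kappa>$2 * \<tau>$2 = 0"
    using assms by (simp_all add: inner_vec_def sum_2)
  have "\<tau>$1 * (\<kappa>$1 * \<nu>$2 - \<kappa>$2 * \<nu>$1) = 0" "\<tau>$2 * (\<kappa>$1 * \<nu>$2 - \<kappa>$2 * \<nu>$1) = 0"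
    using o by algebra+
  moreover have "\<tau>$1 \<noteq> 0 \<or> \<tau>$2 \<noteq> 0"
    using assms(4) by (auto simp: vec_eq_iff forall_2)
  ultimately have "\<kappa>$1 * \<nu>$2 - \<kappa>$2 * \<nu>$1 = 0" by auto
  then show ?thesis
    using \<nu> unfolding power2_norm_eq_inner inner_vec_def sum_2 inner_real_def by algebra
qed

lemma smooth_closed_immersion_derivatives:
  assumes "smooth_closed_immersion \<gamma>"
  defines "g \<equiv> lift \<gamma>"
  shows "(g has_vector_derivative deriv_u g u) (at u)"
    and "(deriv_u g has_vector_derivative deriv_u (deriv_u g) u) (at u)"
    and "isCont (deriv_u (deriv_u g)) u"
    and "deriv_u g u \<noteq> 0"
proof -
  have d: "(deriv_u ^^ n) g differentiable (at u)" for n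
    using assms by (simp add: smooth_closed_immersion_def smooth_def)
  show "(g has_vector_derivative deriv_u g u) (at u)"
       "(deriv_u g has_vector_derivative deriv_u (deriv_u g) u) (at u)"
    using d [of 0] d [of 1] by (simp_all add: deriv_u_def vector_derivative_works)
  show "isCont (deriv_u (deriv_u g)) u"
    using d [of 2] by (simp add: numeral_2_eq_2 differentiable_imp_continuous_within)
  show "deriv_u g u \<noteq> 0"
    using assms by (simp add: smooth_closed_immersion_def)
qed

lemma deriv_u_periodic:
  assumes "\<And>u. f (u + 2 * pi) = f u"
  shows "deriv_u f (u + 2 * pi) = deriv_u f u"
  unfolding deriv_u_def using assms by (rule vector_derivative_periodic)

text \<open>The variance of \<open>k\<close> for the measure \<open>v du\<close> is the mean square minus the squared mean; both
  sides are multiplied by \<open>L\<^sup>2\<close>.\<close>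

lemma integral_variance:
  fixes k v :: "real \<Rightarrow> real"
  assumes "continuous_on {a..b} k" "continuous_on {a..b} v" "integral {a..b} v \<noteq> 0"
  defines "L \<equiv> integral {a..b} v" and "I \<equiv> integral {a..b} (\<lambda>u. k u * v u)"
  shows "L * integral {a..b} (\<lambda>u. (k u - 1 / L * I)\<^sup>2 * v u)
    = L * integral {a..b} (\<lambda>u. (k u)\<^sup>2 * v u) - I\<^sup>2"
proof -
  define c where "c = 1 / L * I"
  have "integral {a..b} (\<lambda>u. (k u - c)\<^sup>2 * v u)
      = integral {a..b} (\<lambda>u. (k u)\<^sup>2 * v u - 2 * c * (k u * v u) + c\<^sup>2 * v u)"
    by (simp add: power2_eq_square algebra_simps)
  also have "\<dots> = integral {a..b} (\<lambda>u. (k u)\<^sup>2 * v u) - 2 * c * I + c\<^sup>2 * L"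
    unfolding L_def I_def
    by (subst integral_add integral_diff integral_mult_right;
        (intro integrable_continuous_real continuous_intros assms)?)+ simp
  finally have expand: "integral {a..b} (\<lambda>u. (k u - c)\<^sup>2 * v u)
      = integral {a..b} (\<lambda>u. (k u)\<^sup>2 * v u) - 2 * c * I + c\<^sup>2 * L" .
  have "L * integral {a..b} (\<lambda>u. (k u - c)\<^sup>2 * v u)
      = L * integral {a..b} (\<lambda>u. (k u)\<^sup>2 * v u) - 2 * (c * L) * I + (c * L)\<^sup>2"
    unfolding expand by algebra
  moreover have "c * L = I"
    using assms(3) by (simp add: c_def L_def)
  ultimately show ?thesis
    unfolding c_def [symmetric] by (simp add: power2_eq_square)
qed

text \<open>Both facts come from one computation: the derivative \<open>\<kappa>\<close> of the unit tangent in arc-length is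
  continuous, periodic and normal to the curve, and its norm is the absolute value of the curvature.
  The multiplicity bound at a single parameter shows moreover that the length is nonzero, which the
  formula for \<open>K_osc\<close> needs.\<close>

lemma
  assumes \<gamma>: "smooth_closed_immersion \<gamma>" and \<nu>: "unit_normal_field \<gamma> \<nu>"
  shows K_osc_eq: "K_osc \<gamma> \<nu> = curve_length \<gamma> * integral_ds \<gamma> (\<lambda>u. (curvature \<gamma> \<nu> u)\<^sup>2)
           - (integral_ds \<gamma> (curvature \<gamma> \<nu>))\<^sup>2"
    and length_energy_ge_multiplicity: "\<And>A x. finite A \<Longrightarrow> A \<subseteq> {z \<in> sphere 0 1. \<gamma> z = x} \<Longrightarrow>
           16 * (real (card A))\<^sup>2 \<le> curve_length \<gamma> * integral_ds \<gamma> (\<lambda>u. (curvature \<gamma> \<nu> u)\<^sup>2)"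
proof -
  define g where "g = lift \<gamma>"
  define v where "v = speed \<gamma>"
  define T where "T = deriv_s \<gamma> g"
  define \<kappa> where "\<kappa> = deriv_s \<gamma> T"
  define k where "k = curvature \<gamma> \<nu>"
  note d = smooth_closed_immersion_derivatives [OF \<gamma>, folded g_def]
  have v: "v u = norm (deriv_u g u)" "v u > 0" for u
    using d(4) by (simp_all add: v_def speed_def g_def)
  have T: "T u = deriv_u g u /\<^sub>R norm (deriv_u g u)" for u
    by (simp add: T_def deriv_s_def g_def speed_def)
  have DT: "(T has_vector_derivative deriv_u (deriv_u g) u /\<^sub>R v u
      - ((deriv_u g u \<bullet> deriv_u (deriv_u g) u) / v u ^ 3) *\<^sub>R deriv_u g u) (at u)" for u
    using unit_vector_derivative [OF d(2,4)] by (simp add: T [abs_def] v(1))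
  have \<kappa>: "\<kappa> u = (deriv_u (deriv_u g) u /\<^sub>R v u
      - ((deriv_u g u \<bullet> deriv_u (deriv_u g) u) / v u ^ 3) *\<^sub>R deriv_u g u) /\<^sub>R v u" for u
    using vector_derivative_at [OF DT] by (simp add: \<kappa>_def deriv_s_def deriv_u_def v_def)
  have D: "(g has_vector_derivative v u *\<^sub>R T u) (at u)" "(T has_vector_derivative v u *\<^sub>R \<kappa> u) (at u)" for u
    using d(1) DT [of u] v(2) [of u] by (simp_all add: T \<kappa> flip: v(1))
  have unit: "norm (T u) = 1" for u
    using d(4) by (simp add: T)
  have orth_g: "\<kappa> u \<bullet> deriv_u g u = 0" for u
  proof -
    have "deriv_u g u \<bullet> deriv_u g u = (v u)\<^sup>2"
      by (simp add: v(1) power2_norm_eq_inner)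
    then show ?thesis
      unfolding \<kappa> inner_scaleR_left inner_diff_left using v(2) [of u]
      by (simp add: inner_commute [of "deriv_u (deriv_u g) u"] power2_eq_square power3_eq_cube)
         (simp add: field_simps)
  qed
  then have orth: "\<kappa> u \<bullet> T u = 0" for u
    by (simp add: T)
  have cont_g': "isCont (deriv_u g) u" for u
    using has_vector_derivative_continuous [OF d(2)] .
  have cont_v: "isCont v u" for u
    unfolding v(1) [abs_def] by (intro continuous_intros cont_g')
  have cont_\<kappa>: "isCont \<kappa> u" for u
    unfolding \<kappa> [abs_def] using v(2) [of u]
    by (intro continuous_intros cont_g' cont_v d(3)) auto
  have k: "k u = \<kappa> u \<bullet> lift \<nu> u" for u
    by (simp add: k_def curvature_def \<kappa>_def T_def g_def)
  have cont_\<nu>: "continuous_on {a..b} (lift \<nu>)" for a b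
    using \<nu> unfolding lift_def unit_normal_field_def
    by (intro continuous_on_compose2 [where g = \<nu> and f = cis and t = "sphere 0 1"] continuous_intros) auto
  have cont_k: "continuous_on {a..b} k" for a b
    unfolding k [abs_def]
    by (intro continuous_intros cont_\<nu> continuous_at_imp_continuous_on ballI cont_\<kappa>)
  have k_norm: "(norm (\<kappa> u))\<^sup>2 = (k u)\<^sup>2" for u
    unfolding k using \<nu> orth_g d(4)
    by (intro plane_norm_eq_normal_component [where \<tau> = "deriv_u g u"]) (auto simp: unit_normal_field_def g_def)
  have per: "g (u + 2 * pi) = g u" for u
  proof -
    have "cis (u + 2 * pi) = cis u"
      by (simp add: complex_eq_iff)
    then show ?thesis
      by (simp add: g_def lift_def)
  qed
  then have per_g': "deriv_u g (u + 2 * pi) = deriv_u g u" for u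
    by (rule deriv_u_periodic)
  then have per_g'': "deriv_u (deriv_u g) (u + 2 * pi) = deriv_u (deriv_u g) u" for u
    by (rule deriv_u_periodic)
  have per_v: "v (u + 2 * pi) = v u" for u
    by (simp add: v(1) per_g')
  have per_\<kappa>: "\<kappa> (u + 2 * pi) = \<kappa> u" for u
    by (simp add: \<kappa> per_v per_g' per_g'')
  have energy: "integral_ds \<gamma> (\<lambda>u. (curvature \<gamma> \<nu> u)\<^sup>2) = integral {0..2 * pi} (\<lambda>u. (k u)\<^sup>2 * v u)"
    by (simp add: integral_ds_def k_def v_def)
  have length: "curve_length \<gamma> = integral {0..2 * pi} v"
    by (simp add: curve_length_def v_def)

  have bound: "16 * (real (card A))\<^sup>2 \<le> curve_length \<gamma> * integral_ds \<gamma> (\<lambda>u. (curvature \<gamma> \<nu> u)\<^sup>2)"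
    if A: "finite A" "A \<subseteq> {z \<in> sphere 0 1. \<gamma> z = x}" for A x
  proof -
    have cis: "cis (Arg2pi z) = z" if "z \<in> A" for z
      using A(2) that complex_norm_eq_1_exp [of z] by (auto simp: cis_conv_exp)
    then have "inj_on Arg2pi A"
      by (metis inj_onI)
    then have "card (Arg2pi ` A) = card A"
      by (rule card_image)
    moreover have "16 * (real (card (Arg2pi ` A)))\<^sup>2
        \<le> integral {0..2 * pi} v * integral {0..2 * pi} (\<lambda>u. v u * (norm (\<kappa> u))\<^sup>2)"
    proof (intro multiplicity_bound [OF per per_v per_\<kappa> D unit orth v(2) cont_v cont_\<kappa>])
      show "finite (Arg2pi ` A)" using A by simp
      show "Arg2pi ` A \<subseteq> {0..<2 * pi}" using Arg2pi_ge_0 Arg2pi_lt_2pi by auto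
      show "g u = x" if "u \<in> Arg2pi ` A" for u
        using that A(2) cis by (auto simp: g_def lift_def)
    qed
    moreover have "(\<lambda>u. v u * (norm (\<kappa> u))\<^sup>2) = (\<lambda>u. (k u)\<^sup>2 * v u)"
      by (simp add: k_norm mult.commute)
    ultimately show ?thesis
      by (simp only: length energy)
  qed
  then show "16 * (real (card A))\<^sup>2 \<le> curve_length \<gamma> * integral_ds \<gamma> (\<lambda>u. (curvature \<gamma> \<nu> u)\<^sup>2)"
    if "finite A" "A \<subseteq> {z \<in> sphere 0 1. \<gamma> z = x}" for A x
    using that .

  have "16 * (real (card {1 :: complex}))\<^sup>2 \<le> curve_length \<gamma> * integral_ds \<gamma> (\<lambda>u. (curvature \<gamma> \<nu> u)\<^sup>2)"
    by (rule bound [where x = "\<gamma> 1"]) auto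
  then have "integral {0..2 * pi} v \<noteq> 0"
    by (auto simp: length)
  then show "K_osc \<gamma> \<nu> = curve_length \<gamma> * integral_ds \<gamma> (\<lambda>u. (curvature \<gamma> \<nu> u)\<^sup>2)
           - (integral_ds \<gamma> (curvature \<gamma> \<nu>))\<^sup>2"
    unfolding energy K_osc_def avg_curvature_def length integral_ds_def k_def [symmetric] v_def [symmetric]
    by (intro integral_variance cont_k continuous_at_imp_continuous_on ballI cont_v)
qed

lemma ecard_le:
  assumes "\<And>A. finite A \<Longrightarrow> A \<subseteq> S \<Longrightarrow> card A \<le> N"
  shows "ecard S \<le> enat N"
proof (cases "finite S")
  case False
  then obtain A where "finite A" "card A = Suc N" "A \<subseteq> S"
    using infinite_arbitrarily_large by blast
  then show ?thesis using assms [of A] by simp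
qed (use assms in \<open>simp add: ecard_def\<close>)

theorem theorem1p6:
  fixes \<gamma> \<nu> :: "complex \<Rightarrow> real^2" and \<omega> :: real and m :: enat
  assumes "smooth_closed_immersion \<gamma>"
    and "unit_normal_field \<gamma> \<nu>"
    and "integral_ds \<gamma> (curvature \<gamma> \<nu>) = 2 * \<omega> * pi"
    and "m = max_multiplicity \<gamma>"
  shows "ereal (K_osc \<gamma> \<nu>) \<ge> 16 * (ereal_of_enat m)\<^sup>2 - ereal (4 * \<omega>\<^sup>2 * pi\<^sup>2)"
proof -
  define C where "C = curve_length \<gamma> * integral_ds \<gamma> (\<lambda>u. (curvature \<gamma> \<nu> u)\<^sup>2)"
  note bound = length_energy_ge_multiplicity [OF assms(1,2), folded C_def]
  \<comment> \<open>The natural numbers \<open>n\<close> with \<open>16 n\<^sup>2 \<le> C\<close> are those up to \<open>N\<close>, so \<open>m\<close> is finite.\<close>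
  define N where "N = nat \<lfloor>sqrt C / 4\<rfloor>"
  have C: "C \<ge> 0" using bound [of "{}"] by simp
  have "ecard {z \<in> sphere 0 1. \<gamma> z = x} \<le> enat N" for x
  proof (rule ecard_le)
    fix A assume A: "finite A" "A \<subseteq> {z \<in> sphere 0 1. \<gamma> z = x}"
    have "(4 * real (card A))\<^sup>2 \<le> C"
      using bound [OF A] by (simp add: power_mult_distrib)
    then have "4 * real (card A) \<le> sqrt C"
      by (rule real_le_rsqrt)
    then show "card A \<le> N"
      by (simp add: N_def le_nat_floor)
  qed
  then have "m \<le> enat N"
    unfolding assms(4) max_multiplicity_def by (intro SUP_least) auto
  then obtain M where M: "m = enat M" "M \<le> N"
    by (cases m) auto
  have "real M \<le> sqrt C / 4"
  proof -
    have "real M \<le> real N"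
      using M(2) by simp
    also have "\<dots> \<le> sqrt C / 4"
      unfolding N_def using C by (intro of_nat_floor) simp
    finally show ?thesis .
  qed
  then have "(4 * real M)\<^sup>2 \<le> (sqrt C)\<^sup>2"
    by (intro power_mono) auto
  then have "16 * (real M)\<^sup>2 \<le> C"
    using C by (simp add: power_mult_distrib)
  moreover have "K_osc \<gamma> \<nu> = C - 4 * \<omega>\<^sup>2 * pi\<^sup>2"
    unfolding K_osc_eq [OF assms(1,2)] assms(3) C_def by (simp add: power_mult_distrib)
  moreover have "16 * (ereal_of_enat m)\<^sup>2 - ereal (4 * \<omega>\<^sup>2 * pi\<^sup>2)
      = ereal (16 * (real M)\<^sup>2 - 4 * \<omega>\<^sup>2 * pi\<^sup>2)"
    by (simp add: M(1))
  ultimately show ?thesis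
    by simp
qed

end
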